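(* For all integers $k\geq 0$ and $n\geq 1$, $$\sum_{i=0}^{n}\binom{n+k}{n-i}B_{n-i}^{(k)}\,S(i+k,k)=0,$$ where $B_j^{(k)}$ are the generalized Bernoulli numbers and $S(\cdot,\cdot)$ the Stirling numbers of the second kind. In particular, for all $n\ge 1$, the Bernoulli numbers $B_j$ satisfy $$\sum_{i=0}^{n}\binom{n+1}{n-i}B_{n-i}=0.$$
   Context: For any integer $m$, the generalized Bernoulli numbers $B_n^{(m)}$ are defined by the formal power series identity $\left(1+\sum_{n\geq 1}\frac{1}{(n+1)!}X^{n}\right)^{-m}=1+\sum_{n\geq 1}\frac{1}{n!}B_{n}^{(m)}X^{n}$, with $B_0^{(m)}=1$; the Bernoulli numbers are $B_n=B_n^{(1)}$. The Stirling numbers of the second kind $S(n,k)$ are defined by $\frac{1}{k!}\left(\sum_{n\geq 1}\frac{1}{n!}X^{n}\right)^{k}=\sum_{n\geq k}\frac{1}{n!}S(n,k)X^{n}$. *)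

theory Defs
  imports
    "HOL-Computational_Algebra.Formal_Power_Series"
    "HOL-Combinatorics.Stirling"
begin

text \<open>
  The base series is \<open>1 + (\<Sum>n\<ge>1. X^n / (n+1)!)\<close>; its constant term is covered by the
  same formula since \<open>1 / 1! = 1\<close>. As this constant term is nonzero, the library's
  \<^const>\<open>inverse\<close> on power series, and hence \<^const>\<open>power_int\<close>, is the genuine one.
\<close>

definition gen_bernoulli :: "int \<Rightarrow> nat \<Rightarrow> rat" where
  "gen_bernoulli m n = fact n * fps_nth (Abs_fps (\<lambda>j. 1 / fact (j + 1)) powi (- m)) n"

definition bernoulli :: "nat \<Rightarrow> rat" where
  "bernoulli n = gen_bernoulli 1 n"

lemma gen_bernoulli_egf:
  "(1 + Abs_fps (\<lambda>n. if n = 0 then 0 else 1 / fact (n + 1))) powi (- m) =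
     Abs_fps (\<lambda>n. gen_bernoulli m n / fact n)"
proof -
  have "1 + Abs_fps (\<lambda>n. if n = 0 then 0 else 1 / fact (n + 1)) =
      (Abs_fps (\<lambda>j. 1 / fact (j + 1)) :: rat fps)"
    by (rule fps_ext) simp
  then show ?thesis
    by (intro fps_ext) (simp add: gen_bernoulli_def)
qed

lemma gen_bernoulli_0: "gen_bernoulli m 0 = 1"
  by (simp add: gen_bernoulli_def power_int_def fps_power_zeroth)

text \<open>
  The library defines \<^const>\<open>Stirling\<close>, the Stirling numbers of the second kind, by their
  recurrence; they have the expected exponential generating function.
\<close>

lemma Stirling_egf:
  "fps_const (1 / fact k) * Abs_fps (\<lambda>n. if n = 0 then 0 else 1 / fact n) ^ k =
     Abs_fps (\<lambda>n. of_nat (Stirling n k) / fact n :: rat)"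
proof -
  define E :: "rat fps" where "E = Abs_fps (\<lambda>n. if n = 0 then 0 else 1 / fact n)"
  define F :: "nat \<Rightarrow> rat fps" where "F k = fps_const (1 / fact k) * E ^ k" for k
  have dE: "fps_deriv E = 1 + E"
    by (rule fps_ext) (simp add: E_def field_simps del: of_nat_Suc)
  have E0: "fps_nth E 0 = 0"
    by (simp add: E_def)
  have dF: "fps_deriv (F (Suc k)) = F k + fps_const (of_nat (Suc k)) * F (Suc k)" for k
  proof -
    have c: "fps_const (1 / fact (Suc k)) * fps_const (of_nat (Suc k)) =
        (fps_const (1 / fact k) :: rat fps)"
      by (simp add: fact_Suc del: of_nat_Suc)
    have "fps_deriv (F (Suc k)) =
        (fps_const (1 / fact (Suc k)) * fps_const (of_nat (Suc k))) * ((1 + E) * E ^ k)"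
      unfolding F_def
      by (simp only: fps_deriv_mult fps_deriv_power fps_deriv_const dE diff_Suc_1)
         (simp add: algebra_simps)
    also have "\<dots> = F k + (fps_const (1 / fact (Suc k)) * fps_const (of_nat (Suc k))) * E ^ Suc k"
      unfolding c by (simp add: F_def algebra_simps)
    finally show ?thesis
      by (simp only: F_def mult_ac)
  qed
  have F0: "fps_nth (F (Suc k)) 0 = 0" for k
    by (simp add: F_def E0)
  have "fps_nth (F k) n = of_nat (Stirling n k) / fact n" for n
  proof (induction n k rule: Stirling.induct)
    case (4 n k)
    have "of_nat (Suc n) * fps_nth (F (Suc k)) (Suc n) = fps_nth (fps_deriv (F (Suc k))) n"
      by simp
    also have "\<dots> = fps_nth (F k) n + of_nat (Suc k) * fps_nth (F (Suc k)) n"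
      by (simp only: dF fps_add_nth fps_mult_left_const_nth)
    also have "\<dots> = of_nat (Stirling (Suc n) (Suc k)) / fact n"
      by (simp add: 4 add_divide_distrib algebra_simps)
    finally show ?case
      by (simp add: field_simps del: of_nat_Suc Stirling.simps)
  qed (simp_all add: F_def E0)
  then show ?thesis
    by (intro fps_ext) (simp add: F_def E_def)
qed

end

theory Submission
  imports Defs
begin

text \<open>
  Write \<open>G = 1 + X/2! + X\<^sup>2/3! + \<dots>\<close>. The generalized Bernoulli numbers of order \<open>k\<close> are the
  exponential coefficients of \<open>G\<close> to the power \<open>-k\<close>. Since \<open>e^X - 1 = X * G\<close>, the generating
  function of the Stirling numbers of the second kind is \<open>X^k * G^k / k!\<close>, so, after a shift of
  the index by \<open>k\<close>, these numbers describe the coefficients of \<open>G^k\<close>. The two families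
  therefore belong to mutually inverse power series, and comparing the coefficients of \<open>X^n\<close>
  for \<open>n \<ge> 1\<close> in the product gives a vanishing convolution. Multiplication by \<open>(n+k)!/k!\<close>
  collects the factorials into the binomial coefficients of the theorem. For \<open>k = 1\<close> all
  Stirling numbers that occur equal 1, which leaves the classical recurrence for the Bernoulli
  numbers.
\<close>

text \<open>
  This is the Stirling generating function with the factor \<open>X^k\<close> of \<open>(e^X - 1)^k\<close> cancelled.
\<close>

lemma fps_nth_exp_quotient_power:
  "fps_nth (Abs_fps (\<lambda>j. 1 / fact (j + 1)) ^ k) i =
     (fact k * of_nat (Stirling (i + k) k) / fact (i + k) :: rat)"
proof -
  define G :: "rat fps" where "G = Abs_fps (\<lambda>j. 1 / fact (j + 1))"
  have "Abs_fps (\<lambda>n. if n = 0 then 0 else 1 / fact n) = fps_X * G"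
    by (rule fps_ext) (simp add: G_def fact_reduce)
  then have "fps_const (1 / fact k) * (fps_X * G) ^ k =
      Abs_fps (\<lambda>n. of_nat (Stirling n k) / fact n)"
    using Stirling_egf[of k] by simp
  then have "fps_nth (fps_const (1 / fact k) * (fps_X * G) ^ k) (i + k) =
      of_nat (Stirling (i + k) k) / fact (i + k)"
    by simp
  then have "fps_nth (G ^ k) i / fact k = of_nat (Stirling (i + k) k) / fact (i + k)"
    by (simp add: power_mult_distrib fps_X_power_mult_nth)
  then show ?thesis
    by (simp add: G_def field_simps)
qed

text \<open>
  Here the convolution of \<open>G^k\<close> with its inverse is read off; the hypothesis \<open>n \<ge> 1\<close> says
  that the coefficient of \<open>X^n\<close> in the constant series 1 is 0.
\<close>

lemma gen_bernoulli_Stirling_sum: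
  assumes "n \<ge> 1"
  shows "(\<Sum>i=0..n. of_nat ((n + k) choose (n - i)) * gen_bernoulli (int k) (n - i)
            * of_nat (Stirling (i + k) k)) = 0"
proof -
  define G :: "rat fps" where "G = Abs_fps (\<lambda>j. 1 / fact (j + 1))"
  have "G * inverse G = 1"
    by (simp add: inverse_mult_eq_1' G_def)
  moreover have "G powi (- int k) = inverse G ^ k"
    by (cases k) (simp_all add: power_int_def nat_add_distrib)
  ultimately have inv: "G ^ k * G powi (- int k) = 1"
    by (simp flip: power_mult_distrib)
  have "of_nat ((n + k) choose (n - i)) * gen_bernoulli (int k) (n - i)
            * of_nat (Stirling (i + k) k) =
        fact (n + k) / fact k * (fps_nth (G ^ k) i * fps_nth (G powi (- int k)) (n - i))"
    if "i \<in> {0..n}" for i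
  proof -
    have "n + k - (n - i) = i + k"
      using that by auto
    then have "(of_nat ((n + k) choose (n - i)) :: rat) =
        fact (n + k) / (fact (n - i) * fact (i + k))"
      by (simp add: binomial_fact)
    then show ?thesis
      unfolding G_def fps_nth_exp_quotient_power gen_bernoulli_def by simp
  qed
  then have "(\<Sum>i=0..n. of_nat ((n + k) choose (n - i)) * gen_bernoulli (int k) (n - i)
            * of_nat (Stirling (i + k) k)) =
      fact (n + k) / fact k * fps_nth (G ^ k * G powi (- int k)) n"
    by (simp add: fps_mult_nth sum_distrib_left)
  also have "\<dots> = 0"
    unfolding inv using assms by simp
  finally show ?thesis .
qed

theorem theorem2p7:
  shows "(\<forall>(k::nat) (n::nat). n \<ge> 1 \<longrightarrow>
            (\<Sum>i=0..n. of_nat ((n + k) choose (n - i)) * gen_bernoulli (int k) (n - i)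
                        * of_nat (Stirling (i + k) k)) = 0)
         \<and> (\<forall>n::nat. n \<ge> 1 \<longrightarrow>
            (\<Sum>i=0..n. of_nat ((n + 1) choose (n - i)) * bernoulli (n - i)) = 0)"
proof (intro conjI allI impI)
  fix k n :: nat
  assume "n \<ge> 1"
  then show "(\<Sum>i=0..n. of_nat ((n + k) choose (n - i)) * gen_bernoulli (int k) (n - i)
                * of_nat (Stirling (i + k) k)) = 0"
    by (rule gen_bernoulli_Stirling_sum)
next
  fix n :: nat
  assume "n \<ge> 1"
  \<comment> \<open>The recurrence has to stay folded, so that \<open>Stirling (i + 1) 1\<close> rewrites to 1.\<close>
  then show "(\<Sum>i=0..n. of_nat ((n + 1) choose (n - i)) * bernoulli (n - i)) = 0"
    using gen_bernoulli_Stirling_sum[of n 1]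
    by (simp add: bernoulli_def del: Stirling.simps)
qed

end
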